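(* For every $\epsilon\in(0,\epsilon_0)$ and every initial condition $y_0\in M$ with $\delta_\epsilon(y_0)\le\frac12$, $$z_\epsilon(y_0)\le 6e^{2L}\bigl(\delta_\epsilon(y_0)+S_\epsilon\bigr).$$
   Context: Let $M$ be a measurable space, $d\ge1$, $\epsilon_0>0$. Let $T_\epsilon:M\to M$, $0\le\epsilon<\epsilon_0$, be a family of measurable transformations and, for each $\epsilon$, let $\nu_\epsilon$ be a $T_\epsilon$-invariant ergodic probability measure on $M$. Let $a:\mathbb{R}^d\times M\times[0,\epsilon_0)\to\mathbb{R}^d$ be a function, measurable in the $M$-variable, and fix $x_0\in\mathbb{R}^d$. Norms: on $\mathbb{R}^n$, $|x|=\max_i|x_i|$; on matrices, $|\cdot|$ is the operator norm induced by these norms. Write $D=\partial/\partial x$. For $g:\mathbb{R}^d\times M\times[0,\epsilon_0)\to\mathbb{R}^n$ (or matrix valued), $\|g\|_{\mathrm{Lip}}=\sup_{y\in M}\sup_{\epsilon\in[0,\epsilon_0)}\max\{\sup_x|g(x,y,\epsilon)|,\ \sup_{x\ne x'}|g(x,y,\epsilon)-g(x',y,\epsilon)|/|x-x'|\}$; for $E\subset\mathbb{R}^d$, $\|g|_E\|_{\mathrm{Lip}}$ is the same quantity with $x,x'$ restricted to $E$. Assumptions: there are constants $L_1,L_2,L_3\ge1$ such that $\|a\|_{\mathrm{Lip}}\le L_1$; with $E=\{x\in\mathbb{R}^d:|x-x_0|\le L_1\}$, $\|Da|_E\|_{\mathrm{Lip}}\le L_2$; and $\sup_{x\in E}\sup_{y\in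 M}|a(x,y,\epsilon)-a(x,y,0)|\le L_3\epsilon$ for all $\epsilon$. Set $L=\max\{L_1,L_2,L_3\}$. Fast-slow system: for $y_0\in M$, $x^{(\epsilon)}_0=x_0$, $y^{(\epsilon)}_0=y_0$, $x^{(\epsilon)}_{n+1}=x^{(\epsilon)}_n+\epsilon a(x^{(\epsilon)}_n,y^{(\epsilon)}_n,\epsilon)$, $y^{(\epsilon)}_{n+1}=T_\epsilon y^{(\epsilon)}_n$. Put $\hat x^{(\epsilon)}(t)=x^{(\epsilon)}_{[t/\epsilon]}$ for $t\in[0,1]$. Let $X$ solve $\dot X=\bar a(X)$, $X(0)=x_0$, where $\bar a(x)=\int_M a(x,y,0)\,d\nu_0(y)$. Define $z_\epsilon=z_\epsilon(y_0)=\sup_{t\in[0,1]}|\hat x^{(\epsilon)}(t)-X(t)|$. Order function: let $\bar a(x,\epsilon)=\int_M a(x,y,\epsilon)\,d\nu_\epsilon(y)$, $v_{\epsilon,x}(y)=a(x,y,\epsilon)-\bar a(x,\epsilon)$, $v_{\epsilon,x,n}=\sum_{j=0}^{n-1}v_{\epsilon,x}\circ T_\epsilon^j$, $V_{\epsilon,x,n}=\sum_{j=0}^{n-1}(Dv_{\epsilon,x})\circ T_\epsilon^j$, and $\delta_{1,\epsilon}=\sup_{x\in E}\sup_{1\le n\le1/\epsilon}\epsilon|v_{\epsilon,x,n}|$, $\delta_{2,\epsilon}=\sup_{x\in E}\sup_{1\le n\le1/\epsilon}\epsilon|V_{\epsilon,x,n}|$, $\delta_\epsilon=\delta_{1,\epsilon}+\delta_{2,\epsilon}:M\to\mathbb{R}$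 (a supremum over an empty index set is $0$). Finally $S_\epsilon=\sup_{x\in E}\bigl|\int_M a(x,y,0)\,(d\nu_\epsilon-d\nu_0)(y)\bigr|+\epsilon$. *)

theory Defs
  imports "HOL-Probability.Probability"
begin

text \<open>
  The max-norm on \<open>real ^ 'd\<close> is \<^const>\<open>infnorm\<close> (see \<open>infnorm_cart\<close>).  Suprema that may be
  unbounded or range over an empty index set are taken in \<^typ>\<open>ennreal\<close>, where they always
  exist and the supremum of the empty set is \<open>0\<close>.
\<close>

definition mat_infnorm :: "real ^ 'd ^ 'd \<Rightarrow> real" where
  "mat_infnorm A = (SUP h\<in>{h. infnorm h \<le> 1}. infnorm (A *v h))"

lemma bdd_above_mat_infnorm:
  fixes A :: "real ^ 'd ^ 'd"
  shows "bdd_above ((\<lambda>h. infnorm (A *v h)) ` {h. infnorm h \<le> 1})"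
proof (rule bdd_aboveI2)
  fix h :: "real ^ 'd"
  assume h: "h \<in> {h. infnorm h \<le> 1}"
  have "infnorm (A *v h) \<le> norm (A *v h)"
    by (rule infnorm_le_norm)
  also have "\<dots> \<le> onorm ((*v) A) * norm h"
    by (rule onorm) (rule matrix_vector_mul_bounded_linear)
  also have "\<dots> \<le> onorm ((*v) A) * sqrt DIM(real ^ 'd)"
  proof (rule mult_left_mono)
    have "norm h \<le> sqrt DIM(real ^ 'd) * infnorm h"
      by (rule norm_le_infnorm)
    also have "\<dots> \<le> sqrt DIM(real ^ 'd) * 1"
      using h by (intro mult_left_mono) auto
    finally show "norm h \<le> sqrt DIM(real ^ 'd)" by simp
  qed (rule onorm_pos_le[OF matrix_vector_mul_bounded_linear])
  finally show "infnorm (A *v h) \<le> onorm ((*v) A) * sqrt DIM(real ^ 'd)" .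
qed

text \<open>
  \<open>lip_norm_on N E Y I g\<close> is the norm \<open>\<parallel>g|\<^sub>E\<parallel>\<close> (Lipschitz norm), where \<open>N\<close> is the norm on the values
  of \<open>g\<close>, and \<open>y\<close> and \<open>\<epsilon>\<close> range over \<open>Y\<close> and \<open>I\<close>.
\<close>

definition lip_norm_on ::
  "('b::minus \<Rightarrow> real) \<Rightarrow> (real ^ 'd) set \<Rightarrow> 'm set \<Rightarrow> real set
    \<Rightarrow> (real ^ 'd \<Rightarrow> 'm \<Rightarrow> real \<Rightarrow> 'b) \<Rightarrow> ennreal" where
  "lip_norm_on N E Y I g = (SUP y\<in>Y. SUP \<epsilon>\<in>I. max
     (SUP x\<in>E. ennreal (N (g x y \<epsilon>)))
     (SUP (x, x')\<in>{(x, x'). x \<in> E \<and> x' \<in> E \<and> x \<noteq> x'}.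
        ennreal (N (g x y \<epsilon> - g x' y \<epsilon>) / infnorm (x - x'))))"

definition invariant_ergodic_prob :: "'m measure \<Rightarrow> ('m \<Rightarrow> 'm) \<Rightarrow> 'm measure \<Rightarrow> bool" where
  "invariant_ergodic_prob M T \<mu> \<longleftrightarrow>
     sets \<mu> = sets M \<and> prob_space \<mu> \<and> distr \<mu> M T = \<mu> \<and>
     (\<forall>A\<in>sets M. T -` A \<inter> space M = A \<longrightarrow> measure \<mu> A = 0 \<or> measure \<mu> A = 1)"

definition ball_E :: "real ^ 'd \<Rightarrow> real \<Rightarrow> (real ^ 'd) set" where
  "ball_E x0 L1 = {x. infnorm (x - x0) \<le> L1}"

definition Dx :: "(real ^ 'd \<Rightarrow> 'm \<Rightarrow> real \<Rightarrow> real ^ 'd) \<Rightarrow> real ^ 'd \<Rightarrow> 'm \<Rightarrow> real \<Rightarrow> real ^ 'd ^ 'd" where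
  "Dx g x y \<epsilon> = jacobian (\<lambda>\<xi>. g \<xi> y \<epsilon>) (at x)"

primrec slow ::
  "(real ^ 'd \<Rightarrow> 'm \<Rightarrow> real \<Rightarrow> real ^ 'd) \<Rightarrow> (real \<Rightarrow> 'm \<Rightarrow> 'm) \<Rightarrow> real ^ 'd \<Rightarrow> real \<Rightarrow> 'm \<Rightarrow> nat
    \<Rightarrow> real ^ 'd" where
  "slow a T x0 \<epsilon> y0 0 = x0"
| "slow a T x0 \<epsilon> y0 (Suc n) =
     slow a T x0 \<epsilon> y0 n + \<epsilon> *\<^sub>R a (slow a T x0 \<epsilon> y0 n) ((T \<epsilon> ^^ n) y0) \<epsilon>"

definition slow_hat ::
  "(real ^ 'd \<Rightarrow> 'm \<Rightarrow> real \<Rightarrow> real ^ 'd) \<Rightarrow> (real \<Rightarrow> 'm \<Rightarrow> 'm) \<Rightarrow> real ^ 'd \<Rightarrow> real \<Rightarrow> 'm \<Rightarrow> real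
    \<Rightarrow> real ^ 'd" where
  "slow_hat a T x0 \<epsilon> y0 t = slow a T x0 \<epsilon> y0 (nat \<lfloor>t / \<epsilon>\<rfloor>)"

text \<open>The averaged vector field of the limiting equation is \<open>\<lambda>x. abar a \<nu> x 0\<close>.\<close>

definition abar ::
  "(real ^ 'd \<Rightarrow> 'm \<Rightarrow> real \<Rightarrow> real ^ 'd) \<Rightarrow> (real \<Rightarrow> 'm measure) \<Rightarrow> real ^ 'd \<Rightarrow> real \<Rightarrow> real ^ 'd" where
  "abar a \<nu> x \<epsilon> = (\<integral>y. a x y \<epsilon> \<partial>(\<nu> \<epsilon>))"

definition z_err ::
  "(real ^ 'd \<Rightarrow> 'm \<Rightarrow> real \<Rightarrow> real ^ 'd) \<Rightarrow> (real \<Rightarrow> 'm \<Rightarrow> 'm) \<Rightarrow> real ^ 'd \<Rightarrow> (real \<Rightarrow> real ^ 'd)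
    \<Rightarrow> real \<Rightarrow> 'm \<Rightarrow> ennreal" where
  "z_err a T x0 X \<epsilon> y0 = (SUP t\<in>{0..1}. ennreal (infnorm (slow_hat a T x0 \<epsilon> y0 t - X t)))"

definition vdev ::
  "(real ^ 'd \<Rightarrow> 'm \<Rightarrow> real \<Rightarrow> real ^ 'd) \<Rightarrow> (real \<Rightarrow> 'm measure)
    \<Rightarrow> real ^ 'd \<Rightarrow> 'm \<Rightarrow> real \<Rightarrow> real ^ 'd" where
  "vdev a \<nu> x y \<epsilon> = a x y \<epsilon> - abar a \<nu> x \<epsilon>"

definition v_sum ::
  "(real ^ 'd \<Rightarrow> 'm \<Rightarrow> real \<Rightarrow> real ^ 'd) \<Rightarrow> (real \<Rightarrow> 'm \<Rightarrow> 'm) \<Rightarrow> (real \<Rightarrow> 'm measure)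
    \<Rightarrow> real \<Rightarrow> real ^ 'd \<Rightarrow> nat \<Rightarrow> 'm \<Rightarrow> real ^ 'd" where
  "v_sum a T \<nu> \<epsilon> x n y = (\<Sum>j<n. vdev a \<nu> x ((T \<epsilon> ^^ j) y) \<epsilon>)"

definition V_sum ::
  "(real ^ 'd \<Rightarrow> 'm \<Rightarrow> real \<Rightarrow> real ^ 'd) \<Rightarrow> (real \<Rightarrow> 'm \<Rightarrow> 'm) \<Rightarrow> (real \<Rightarrow> 'm measure)
    \<Rightarrow> real \<Rightarrow> real ^ 'd \<Rightarrow> nat \<Rightarrow> 'm \<Rightarrow> real ^ 'd ^ 'd" where
  "V_sum a T \<nu> \<epsilon> x n y = (\<Sum>j<n. Dx (vdev a \<nu>) x ((T \<epsilon> ^^ j) y) \<epsilon>)"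

definition delta1 ::
  "(real ^ 'd \<Rightarrow> 'm \<Rightarrow> real \<Rightarrow> real ^ 'd) \<Rightarrow> (real \<Rightarrow> 'm \<Rightarrow> 'm) \<Rightarrow> (real \<Rightarrow> 'm measure)
    \<Rightarrow> (real ^ 'd) set \<Rightarrow> real \<Rightarrow> 'm \<Rightarrow> ennreal" where
  "delta1 a T \<nu> E \<epsilon> y =
     (SUP x\<in>E. SUP n\<in>{n. 1 \<le> n \<and> real n \<le> 1 / \<epsilon>}. ennreal (\<epsilon> * infnorm (v_sum a T \<nu> \<epsilon> x n y)))"

definition delta2 ::
  "(real ^ 'd \<Rightarrow> 'm \<Rightarrow> real \<Rightarrow> real ^ 'd) \<Rightarrow> (real \<Rightarrow> 'm \<Rightarrow> 'm) \<Rightarrow> (real \<Rightarrow> 'm measure)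
    \<Rightarrow> (real ^ 'd) set \<Rightarrow> real \<Rightarrow> 'm \<Rightarrow> ennreal" where
  "delta2 a T \<nu> E \<epsilon> y =
     (SUP x\<in>E. SUP n\<in>{n. 1 \<le> n \<and> real n \<le> 1 / \<epsilon>}. ennreal (\<epsilon> * mat_infnorm (V_sum a T \<nu> \<epsilon> x n y)))"

definition delta ::
  "(real ^ 'd \<Rightarrow> 'm \<Rightarrow> real \<Rightarrow> real ^ 'd) \<Rightarrow> (real \<Rightarrow> 'm \<Rightarrow> 'm) \<Rightarrow> (real \<Rightarrow> 'm measure)
    \<Rightarrow> (real ^ 'd) set \<Rightarrow> real \<Rightarrow> 'm \<Rightarrow> ennreal" where
  "delta a T \<nu> E \<epsilon> y = delta1 a T \<nu> E \<epsilon> y + delta2 a T \<nu> E \<epsilon> y"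

definition S_err ::
  "(real ^ 'd \<Rightarrow> 'm \<Rightarrow> real \<Rightarrow> real ^ 'd) \<Rightarrow> (real \<Rightarrow> 'm measure) \<Rightarrow> (real ^ 'd) set \<Rightarrow> real
    \<Rightarrow> ennreal" where
  "S_err a \<nu> E \<epsilon> =
     (SUP x\<in>E. ennreal (infnorm ((\<integral>y. a x y 0 \<partial>(\<nu> \<epsilon>)) - (\<integral>y. a x y 0 \<partial>(\<nu> 0))))) + ennreal \<epsilon>"

end

theory Submission
  imports Defs
begin

text \<open>
  The slow variable satisfies \<open>x\<^bsub>n+1\<^esub> = x\<^sub>n + \<epsilon> b(x\<^sub>n) + \<epsilon> v\<^sub>n(x\<^sub>n)\<close>, where \<open>b\<close> is the mean of \<open>a\<close>
  under \<open>\<nu>\<^sub>\<epsilon>\<close> and \<open>v\<^sub>n\<close> is the fluctuation \<open>v = a - b\<close> at the fast state \<open>y\<^sub>n\<close>.  It is thus an Euler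
  scheme for \<open>b\<close>, disturbed by the accumulated fluctuations \<open>\<epsilon> \<Sum> v\<^sub>k(x\<^sub>k)\<close>.  The quantity
  \<open>\<delta>\<close> controls only sums \<open>\<epsilon> \<Sum> v\<^sub>k(x)\<close> at a fixed \<open>x\<close>.  Summation by parts
  (\<open>fluctuation_sum_by_parts\<close>) passes from one to the other: it leaves one such sum, of size
  \<open>\<delta>\<^sub>1\<close>, and the increments of such sums between consecutive \<open>x\<^sub>k\<close>.  There are at most
  \<open>1/\<epsilon>\<close> of these; consecutive points are at most \<open>\<epsilon> L\<^sub>1\<close> apart, so by the mean value inequality each
  increment has size at most \<open>\<epsilon> L\<^sub>1 \<delta>\<^sub>2\<close>, and the total error is at most \<open>\<delta>\<^sub>1 + L\<^sub>1 \<delta>\<^sub>2\<close>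
  (\<open>fluctuation_bound\<close>).

  Replacing \<open>b\<close> by the limiting vector field costs \<open>L\<^sub>3 \<epsilon>\<close> for the change of \<open>a\<close> and \<open>S\<close> for the
  change of measure.  Discrete Gronwall then compares the scheme with the solution of the limiting
  equation at the times \<open>n\<epsilon>\<close> (\<open>perturbed_euler_error\<close>), and the remaining powers of \<open>L\<close> are
  absorbed into \<open>e\<^sup>L\<close>.

  The mean value inequality needs \<open>Dv\<close> to be an actual derivative, hence \<open>b\<close> to be differentiable.
  This is differentiation under the integral sign, by dominated convergence from the Lipschitz
  bound on \<open>a\<close> (\<open>has_derivative_integral_lipschitz\<close>).
\<close>

section \<open>The max-norm\<close>

lemma infnorm_le_cart:
  fixes x :: "real ^ 'd"
  assumes "\<And>i. \<bar>x $ i\<bar> \<le> B"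
  shows "infnorm x \<le> B"
  unfolding infnorm_cart using assms by (intro cSup_least) auto

lemma infnorm_sum_le:
  fixes f :: "'i \<Rightarrow> 'a::euclidean_space"
  shows "infnorm (sum f A) \<le> (\<Sum>i\<in>A. infnorm (f i))"
proof (induction A rule: infinite_finite_induct)
  case (insert i A)
  then show ?case using infnorm_triangle[of "f i" "sum f A"] by simp
qed (simp_all add: infnorm_0)

lemma infnorm_mat_mult_le:
  fixes A :: "real ^ 'd ^ 'd"
  shows "infnorm (A *v h) \<le> mat_infnorm A * infnorm h"
proof (cases "h = 0")
  case True
  then show ?thesis by (simp add: infnorm_0)
next
  case False
  then have pos: "infnorm h > 0" by (simp add: infnorm_pos_lt)
  let ?u = "(1 / infnorm h) *\<^sub>R h"
  have "infnorm ?u \<le> 1" using pos by (simp add: infnorm_mul)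
  then have "infnorm (A *v ?u) \<le> mat_infnorm A"
    unfolding mat_infnorm_def by (intro cSUP_upper bdd_above_mat_infnorm) auto
  moreover have "A *v ?u = (1 / infnorm h) *\<^sub>R (A *v h)"
    by (rule matrix_vector_mult_scaleR)
  ultimately show ?thesis using pos by (simp add: infnorm_mul field_simps)
qed

lemma sum_matrix_vector_mult:
  fixes A :: "'i \<Rightarrow> real ^ 'n ^ 'm"
  shows "(\<Sum>i\<in>S. A i) *v h = (\<Sum>i\<in>S. A i *v h)"
  by (induction S rule: infinite_finite_induct) (simp_all add: matrix_vector_mult_add_rdistrib)

text \<open>
  The mean value inequality is applied to each coordinate, which keeps the constant free of the
  dimension-dependent factor that comparison with the Euclidean norm would introduce.
\<close>

lemma infnorm_increment_le:
  fixes f :: "real \<Rightarrow> real ^ 'd"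
  assumes "a \<le> b"
    and der: "\<And>t. t \<in> {a..b} \<Longrightarrow> (f has_vector_derivative f' t) (at t within {a..b})"
    and bound: "\<And>t. t \<in> {a..b} \<Longrightarrow> infnorm (f' t) \<le> B"
  shows "infnorm (f b - f a) \<le> B * (b - a)"
proof (rule infnorm_le_cart)
  fix i
  have "norm (f b $ i - f a $ i) \<le> B * norm (b - a)"
  proof (rule differentiable_bound[where S = "{a..b}" and f' = "\<lambda>t h. h * (f' t $ i)"])
    fix t assume t: "t \<in> {a..b}"
    show "((\<lambda>t. f t $ i) has_derivative (\<lambda>h. h * (f' t $ i))) (at t within {a..b})"
      using bounded_linear.has_derivative[OF bounded_linear_vec_nth[of i]
          der[OF t, unfolded has_vector_derivative_def]] by simp
    have "\<bar>f' t $ i\<bar> \<le> B" using component_le_infnorm_cart[of "f' t" i] bound[OF t] by linarith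
    then show "onorm (\<lambda>h. h * (f' t $ i)) \<le> B"
      by (intro onorm_le) (simp add: abs_mult mult.commute[of B] mult_left_mono)
  qed (use assms(1) in auto)
  then show "\<bar>(f b - f a) $ i\<bar> \<le> B * (b - a)" using assms(1) by simp
qed

lemma infnorm_integral_le:
  fixes f :: "'m \<Rightarrow> real ^ 'd"
  assumes "prob_space \<mu>" "integrable \<mu> f" "\<And>y. y \<in> space \<mu> \<Longrightarrow> infnorm (f y) \<le> B"
  shows "infnorm (integral\<^sup>L \<mu> f) \<le> B"
proof (rule infnorm_le_cart)
  fix i
  interpret prob_space \<mu> by fact
  have eq: "integral\<^sup>L \<mu> f $ i = (\<integral>y. f y $ i \<partial>\<mu>)"
    using integral_bounded_linear[OF bounded_linear_vec_nth[of i] assms(2)] by simp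
  have "integrable \<mu> (\<lambda>y. f y $ i)"
    using integrable_bounded_linear[OF bounded_linear_vec_nth[of i] assms(2)] by simp
  moreover have "\<And>y. y \<in> space \<mu> \<Longrightarrow> \<bar>f y $ i\<bar> \<le> B"
    using component_le_infnorm_cart assms(3) order_trans by blast
  ultimately have "(\<integral>y. \<bar>f y $ i\<bar> \<partial>\<mu>) \<le> (\<integral>y. B \<partial>\<mu>)"
    by (intro integral_mono) auto
  then show "\<bar>integral\<^sup>L \<mu> f $ i\<bar> \<le> B"
    using order_trans[OF integral_abs_bound] by (simp add: eq prob_space)
qed

section \<open>Differentiation under the integral sign\<close>

text \<open>
  The Lipschitz bound dominates the difference quotients, and with them their limits \<open>f' y h\<close>;
  the remainder quotient is therefore bounded by \<open>2K\<close>, and dominated convergence applies along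
  every sequence that tends to \<open>z\<close>.  Measurability of \<open>f' y h\<close> in \<open>y\<close> comes for free, as a
  limit of difference quotients.
\<close>

lemma has_derivative_integral_lipschitz:
  fixes f :: "'a::real_normed_vector \<Rightarrow> 'm \<Rightarrow> 'b::{banach, second_countable_topology}"
  assumes "finite_measure \<mu>"
    and int: "\<And>x. integrable \<mu> (f x)"
    and der: "\<And>y. y \<in> space \<mu> \<Longrightarrow> ((\<lambda>x. f x y) has_derivative f' y) (at z)"
    and lip: "\<And>x y. y \<in> space \<mu> \<Longrightarrow> norm (f x y - f z y) \<le> K * norm (x - z)"
  shows "((\<lambda>x. \<integral>y. f x y \<partial>\<mu>) has_derivative (\<lambda>h. \<integral>y. f' y h \<partial>\<mu>)) (at z)"
proof -
  interpret finite_measure \<mu> by fact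
  define q where "q h n y = real (Suc n) *\<^sub>R (f (z + (1 / real (Suc n)) *\<^sub>R h) y - f z y)" for h n y
  have q_lim: "(\<lambda>n. q h n y) \<longlonglongrightarrow> f' y h" if y: "y \<in> space \<mu>" for h y
  proof -
    have "((\<lambda>t. z + t *\<^sub>R h) has_derivative (\<lambda>t. t *\<^sub>R h)) (at (0::real))"
      by (auto intro!: derivative_eq_intros)
    from diff_chain_at[OF this, of "\<lambda>x. f x y" "f' y"] der[OF y]
    have "((\<lambda>t. f (z + t *\<^sub>R h) y) has_derivative (\<lambda>t. f' y (t *\<^sub>R h))) (at (0::real))"
      by (simp add: o_def)
    then have "((\<lambda>t. f (z + t *\<^sub>R h) y) has_vector_derivative f' y h) (at 0)"
      using linear_cmul[OF has_derivative_linear[OF der[OF y]]] by (simp add: has_vector_derivative_def)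
    then have zero: "((\<lambda>t. norm (f (z + t *\<^sub>R h) y - f z y - t *\<^sub>R f' y h) / norm t) \<longlongrightarrow> 0) (at (0::real))"
      by (simp add: has_vector_derivative_def has_derivative_iff_norm)
    have "((\<lambda>t. norm ((1 / t) *\<^sub>R (f (z + t *\<^sub>R h) y - f z y) - f' y h)) \<longlongrightarrow> 0) (at 0)"
    proof (rule Lim_transform_eventually[OF zero], rule eventually_at_filter[THEN iffD2], rule always_eventually,
        intro allI impI)
      fix t :: real assume "t \<noteq> 0"
      then have "(1 / t) *\<^sub>R (f (z + t *\<^sub>R h) y - f z y) - f' y h =
          (1 / t) *\<^sub>R (f (z + t *\<^sub>R h) y - f z y - t *\<^sub>R f' y h)"
        by (simp add: algebra_simps)
      then show "norm (f (z + t *\<^sub>R h) y - f z y - t *\<^sub>R f' y h) / norm t =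
          norm ((1 / t) *\<^sub>R (f (z + t *\<^sub>R h) y - f z y) - f' y h)"
        by (simp add: divide_inverse mult.commute)
    qed
    then have lim: "((\<lambda>t. (1 / t) *\<^sub>R (f (z + t *\<^sub>R h) y - f z y)) \<longlongrightarrow> f' y h) (at 0)"
      by (simp only: tendsto_norm_zero_iff LIM_zero_iff)
    have "filterlim (\<lambda>n. 1 / real (Suc n)) (at 0) sequentially"
      using LIMSEQ_inverse_real_of_nat by (auto simp: filterlim_at inverse_eq_divide)
    from filterlim_compose[OF lim this] show ?thesis by (simp add: q_def)
  qed
  have f'_le: "norm (f' y h) \<le> K * norm h" if y: "y \<in> space \<mu>" for h y
  proof (rule LIMSEQ_le_const2[OF tendsto_norm[OF q_lim[OF y, of h]]], intro exI allI impI)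
    fix n
    let ?w = "z + (1 / real (Suc n)) *\<^sub>R h"
    have "norm (q h n y) = real (Suc n) * norm (f ?w y - f z y)" by (simp add: q_def)
    also have "\<dots> \<le> real (Suc n) * (K * norm (?w - z))" by (intro mult_left_mono lip[OF y]) simp
    also have "norm (?w - z) = norm h / real (Suc n)" by simp
    also have "real (Suc n) * (K * (norm h / real (Suc n))) = K * norm h" by simp
    finally show "norm (q h n y) \<le> K * norm h" .
  qed
  have f'_meas: "(\<lambda>y. f' y h) \<in> borel_measurable \<mu>" for h
  proof (rule borel_measurable_LIMSEQ_metric[where f = "q h"])
    show "q h n \<in> borel_measurable \<mu>" for n
      unfolding q_def using int by (intro borel_measurable_scaleR borel_measurable_diff) auto
  qed (rule q_lim)
  have f'_int: "integrable \<mu> (\<lambda>y. f' y h)" for h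
    using f'_le f'_meas by (intro integrable_const_bound[where B = "K * norm h"]) auto
  show ?thesis
    unfolding has_derivative_iff_norm
  proof (intro conjI)
    show "bounded_linear (\<lambda>h. \<integral>y. f' y h \<partial>\<mu>)"
    proof (rule bounded_linear_intro[where K = "K * measure \<mu> (space \<mu>)"])
      fix h k :: 'a and r :: real
      have lin: "linear (f' y)" if "y \<in> space \<mu>" for y
        by (rule has_derivative_linear[OF der[OF that]])
      show "(\<integral>y. f' y (h + k) \<partial>\<mu>) = (\<integral>y. f' y h \<partial>\<mu>) + (\<integral>y. f' y k \<partial>\<mu>)"
        by (subst Bochner_Integration.integral_add[symmetric])
          (auto intro!: f'_int Bochner_Integration.integral_cong linear_add lin)
      show "(\<integral>y. f' y (r *\<^sub>R h) \<partial>\<mu>) = r *\<^sub>R (\<integral>y. f' y h \<partial>\<mu>)"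
        by (subst Bochner_Integration.integral_cong[OF refl linear_cmul[OF lin]])
          (auto intro: f'_int)
      have "norm (\<integral>y. f' y h \<partial>\<mu>) \<le> (\<integral>y. norm (f' y h) \<partial>\<mu>)" by (rule integral_norm_bound)
      also have "\<dots> \<le> (\<integral>y. K * norm h \<partial>\<mu>)" by (intro integral_mono integrable_norm f'_int) (auto intro: f'_le)
      finally show "norm (\<integral>y. f' y h \<partial>\<mu>) \<le> norm h * (K * measure \<mu> (space \<mu>))"
        by (simp add: mult_ac)
    qed
    show "((\<lambda>x. norm ((\<integral>y. f x y \<partial>\<mu>) - (\<integral>y. f z y \<partial>\<mu>) - (\<integral>y. f' y (x - z) \<partial>\<mu>)) / norm (x - z)) \<longlongrightarrow> 0) (at z)"
      unfolding tendsto_at_iff_sequentially o_def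
    proof (intro allI impI)
      fix \<xi> :: "nat \<Rightarrow> 'a"
      assume ne: "\<forall>i. \<xi> i \<in> UNIV - {z}" and lim: "\<xi> \<longlonglongrightarrow> z"
      let ?r = "\<lambda>i y. (1 / norm (\<xi> i - z)) *\<^sub>R (f (\<xi> i) y - f z y - f' y (\<xi> i - z))"
      have lim_int: "(\<lambda>i. integral\<^sup>L \<mu> (?r i)) \<longlonglongrightarrow> integral\<^sup>L \<mu> (\<lambda>y. 0)"
      proof (rule integral_dominated_convergence[where w = "\<lambda>y. 2 * K"])
        show "?r i \<in> borel_measurable \<mu>" for i
          using int f'_meas by (intro borel_measurable_scaleR borel_measurable_diff) auto
        show "AE y in \<mu>. (\<lambda>i. ?r i y) \<longlonglongrightarrow> 0"
        proof (rule AE_I2)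
          fix y assume y: "y \<in> space \<mu>"
          have "((\<lambda>x. norm (f x y - f z y - f' y (x - z)) / norm (x - z)) \<longlongrightarrow> 0) (at z)"
            using der[OF y] by (simp add: has_derivative_iff_norm)
          then have "(\<lambda>i. norm (?r i y)) \<longlonglongrightarrow> 0"
            unfolding tendsto_at_iff_sequentially o_def using ne lim by (auto simp: divide_inverse mult.commute)
          then show "(\<lambda>i. ?r i y) \<longlonglongrightarrow> 0" by (rule tendsto_norm_zero_cancel)
        qed
        show "AE y in \<mu>. norm (?r i y) \<le> 2 * K" for i
        proof (rule AE_I2)
          fix y assume y: "y \<in> space \<mu>"
          have pos: "norm (\<xi> i - z) > 0" using ne by simp
          have "norm (f (\<xi> i) y - f z y - f' y (\<xi> i - z)) \<le> 2 * K * norm (\<xi> i - z)"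
            using norm_triangle_ineq4[of "f (\<xi> i) y - f z y" "f' y (\<xi> i - z)"]
              lip[OF y, of "\<xi> i"] f'_le[OF y, of "\<xi> i - z"] by linarith
          then have "norm (f (\<xi> i) y - f z y - f' y (\<xi> i - z)) / norm (\<xi> i - z) \<le> 2 * K"
            by (simp only: pos_divide_le_eq[OF pos])
          then show "norm (?r i y) \<le> 2 * K" by simp
        qed
      qed auto
      have "integral\<^sup>L \<mu> (\<lambda>y. f (\<xi> i) y - f z y - f' y (\<xi> i - z)) =
          (\<integral>y. f (\<xi> i) y \<partial>\<mu>) - (\<integral>y. f z y \<partial>\<mu>) - (\<integral>y. f' y (\<xi> i - z) \<partial>\<mu>)" for i
        using int f'_int by simp
      then show "(\<lambda>i. norm ((\<integral>y. f (\<xi> i) y \<partial>\<mu>) - (\<integral>y. f z y \<partial>\<mu>) -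
          (\<integral>y. f' y (\<xi> i - z) \<partial>\<mu>)) / norm (\<xi> i - z)) \<longlonglongrightarrow> 0"
        using tendsto_norm[OF lim_int] by simp
    qed
  qed
qed

section \<open>Perturbed Euler schemes\<close>

lemma discrete_gronwall:
  fixes e :: "nat \<Rightarrow> real"
  assumes "c \<ge> 0" and step: "\<And>n. n \<le> N \<Longrightarrow> e n \<le> C + c * (\<Sum>k<n. e k)" and "n \<le> N"
  shows "e n \<le> C * (1 + c) ^ n"
  using \<open>n \<le> N\<close>
proof (induction n rule: less_induct)
  case (less n)
  have geom: "c * (\<Sum>k<m. C * (1 + c) ^ k) = C * (1 + c) ^ m - C" for m
    by (induction m) (simp_all add: algebra_simps)
  have "(\<Sum>k<n. e k) \<le> (\<Sum>k<n. C * (1 + c) ^ k)"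
    using less by (intro sum_mono) auto
  then have "c * (\<Sum>k<n. e k) \<le> c * (\<Sum>k<n. C * (1 + c) ^ k)"
    using \<open>c \<ge> 0\<close> by (rule mult_left_mono)
  then show ?case using step[OF less.prems] geom[of n] by linarith
qed

text \<open>
  The hypothesis on \<open>x\<close> bounds the accumulated perturbation and not that of a single step: in the
  application the individual perturbations are of the order of the step itself, and only their
  sums are small.  The term \<open>\<epsilon> K\<^sup>2\<close> is the accumulated local error of the Euler scheme, and the
  final \<open>\<epsilon> K\<close> is how far \<open>X\<close> moves between the last grid point and \<open>t\<close>.
\<close>

lemma perturbed_euler_error:
  fixes x :: "nat \<Rightarrow> real ^ 'd" and g :: "real ^ 'd \<Rightarrow> real ^ 'd" and X :: "real \<Rightarrow> real ^ 'd"
  assumes "\<epsilon> > 0" "K \<ge> 0" "C \<ge> 0"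
    and g_le: "\<And>p. infnorm (g p) \<le> K"
    and g_lip: "\<And>p q. infnorm (g p - g q) \<le> K * infnorm (p - q)"
    and X0: "X 0 = x 0"
    and ode: "\<And>t. t \<in> {0..1} \<Longrightarrow> (X has_vector_derivative g (X t)) (at t within {0..1})"
    and x: "\<And>n. real n * \<epsilon> \<le> 1 \<Longrightarrow> infnorm (x n - (x 0 + \<epsilon> *\<^sub>R (\<Sum>k<n. g (x k)))) \<le> C"
    and t: "t \<in> {0..1}"
  shows "infnorm (x (nat \<lfloor>t / \<epsilon>\<rfloor>) - X t) \<le> exp K * (C + \<epsilon> * K\<^sup>2) + \<epsilon> * K"
proof -
  define N where "N = nat \<lfloor>t / \<epsilon>\<rfloor>"
  define \<tau> where "\<tau> n = real n * \<epsilon>" for n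
  have "real N \<le> t / \<epsilon>" "t / \<epsilon> < real N + 1"
    using t \<open>\<epsilon> > 0\<close> by (simp_all add: N_def of_nat_nat)
  then have N: "\<tau> N \<le> t" "t \<le> \<tau> N + \<epsilon>"
    using \<open>\<epsilon> > 0\<close> by (auto simp: \<tau>_def field_simps)
  have \<tau>_le: "\<tau> n \<le> t" if "n \<le> N" for n
  proof -
    have "real n * \<epsilon> \<le> real N * \<epsilon>" using that \<open>\<epsilon> > 0\<close> by (intro mult_right_mono) auto
    then show ?thesis using N by (simp add: \<tau>_def)
  qed
  have \<tau>_ge: "\<tau> n \<ge> 0" for n using \<open>\<epsilon> > 0\<close> by (simp add: \<tau>_def)
  have X_lip: "infnorm (X s - X r) \<le> K * (s - r)" if "0 \<le> r" "r \<le> s" "s \<le> 1" for r s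
    by (rule infnorm_increment_le[OF that(2), where f' = "\<lambda>t. g (X t)"])
      (use that g_le in \<open>auto intro!: has_vector_derivative_within_subset[OF ode]\<close>)
  have X_step: "infnorm (X (\<tau> (Suc k)) - X (\<tau> k) - \<epsilon> *\<^sub>R g (X (\<tau> k))) \<le> \<epsilon>\<^sup>2 * K\<^sup>2"
    if k: "Suc k \<le> N" for k
  proof -
    let ?r = "\<tau> k" and ?s = "\<tau> (Suc k)"
    have rs: "0 \<le> ?r" "?s = ?r + \<epsilon>" "?s \<le> 1"
      using \<tau>_ge \<tau>_le[OF k] t by (auto simp: \<tau>_def algebra_simps)
    \<comment> \<open>Subtracting the tangent at \<open>?r\<close> leaves a curve whose velocity is itself \<open>O(\<epsilon>)\<close>.\<close>
    have "infnorm ((X ?s - ?s *\<^sub>R g (X ?r)) - (X ?r - ?r *\<^sub>R g (X ?r))) \<le> (K * (K * \<epsilon>)) * (?s - ?r)"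
    proof (rule infnorm_increment_le[where f' = "\<lambda>t. g (X t) - g (X ?r)"])
      fix u assume u: "u \<in> {?r..?s}"
      have "(X has_vector_derivative g (X u)) (at u within {?r..?s})"
        using u rs by (intro has_vector_derivative_within_subset[OF ode]) auto
      then show "((\<lambda>t. X t - t *\<^sub>R g (X ?r)) has_vector_derivative g (X u) - g (X ?r))
          (at u within {?r..?s})"
        by (auto intro!: derivative_eq_intros)
      have "infnorm (X u - X ?r) \<le> K * (u - ?r)" using u rs by (intro X_lip) auto
      also have "\<dots> \<le> K * \<epsilon>" using u rs \<open>K \<ge> 0\<close> by (intro mult_left_mono) auto
      finally show "infnorm (g (X u) - g (X ?r)) \<le> K * (K * \<epsilon>)"
        using g_lip[of "X u" "X ?r"] \<open>K \<ge> 0\<close> mult_left_mono order_trans by blast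
    qed (use rs \<open>\<epsilon> > 0\<close> in auto)
    then show ?thesis using rs by (simp add: algebra_simps power2_eq_square)
  qed
  define d where "d k = infnorm (x k - X (\<tau> k))" for k
  have X_sum: "infnorm (X (\<tau> n) - (x 0 + \<epsilon> *\<^sub>R (\<Sum>k<n. g (X (\<tau> k))))) \<le> \<epsilon> * K\<^sup>2" if n: "n \<le> N" for n
  proof -
    have "X (\<tau> n) - (x 0 + \<epsilon> *\<^sub>R (\<Sum>k<n. g (X (\<tau> k)))) =
        (\<Sum>k<n. X (\<tau> (Suc k)) - X (\<tau> k) - \<epsilon> *\<^sub>R g (X (\<tau> k)))"
      using sum_lessThan_telescope[of "\<lambda>k. X (\<tau> k)" n]
      by (simp add: sum_subtractf scaleR_sum_right X0 \<tau>_def)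
    also have "infnorm \<dots> \<le> (\<Sum>k<n. \<epsilon>\<^sup>2 * K\<^sup>2)"
      by (intro order_trans[OF infnorm_sum_le] sum_mono X_step) (use n in auto)
    also have "\<dots> = \<tau> n * (\<epsilon> * K\<^sup>2)" by (simp add: \<tau>_def power2_eq_square)
    also have "\<dots> \<le> 1 * (\<epsilon> * K\<^sup>2)"
      using \<tau>_le[OF n] t \<open>\<epsilon> > 0\<close> by (intro mult_right_mono) auto
    finally show ?thesis by simp
  qed
  have d_step: "d n \<le> (C + \<epsilon> * K\<^sup>2) + (\<epsilon> * K) * (\<Sum>k<n. d k)" if n: "n \<le> N" for n
  proof -
    let ?A = "x n - (x 0 + \<epsilon> *\<^sub>R (\<Sum>k<n. g (x k)))"
    let ?B = "X (\<tau> n) - (x 0 + \<epsilon> *\<^sub>R (\<Sum>k<n. g (X (\<tau> k))))"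
    let ?G = "\<epsilon> *\<^sub>R (\<Sum>k<n. g (x k) - g (X (\<tau> k)))"
    have "x n - X (\<tau> n) = (?A - ?B) + ?G"
      by (simp add: sum_subtractf algebra_simps)
    then have "infnorm (x n - X (\<tau> n)) \<le> infnorm (?A - ?B) + infnorm ?G"
      by (simp only: infnorm_triangle)
    moreover have "infnorm ?A \<le> C" using \<tau>_le[OF n] t by (intro x) (auto simp: \<tau>_def)
    moreover have "infnorm (?A - ?B) \<le> infnorm ?A + infnorm ?B"
      using infnorm_triangle[of ?A "- ?B"] by (simp only: infnorm_neg diff_conv_add_uminus)
    moreover have "infnorm ?G \<le> \<epsilon> * K * (\<Sum>k<n. d k)"
    proof -
      have "infnorm (\<Sum>k<n. g (x k) - g (X (\<tau> k))) \<le> (\<Sum>k<n. K * d k)"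
        unfolding d_def by (intro order_trans[OF infnorm_sum_le] sum_mono g_lip)
      then show ?thesis using \<open>\<epsilon> > 0\<close> by (simp add: infnorm_mul sum_distrib_left[symmetric])
    qed
    ultimately have "infnorm (x n - X (\<tau> n)) \<le> (C + \<epsilon> * K\<^sup>2) + \<epsilon> * K * (\<Sum>k<n. d k)"
      using X_sum[OF n] by linarith
    then show ?thesis by (simp only: d_def[of n])
  qed
  \<comment> \<open>Since \<open>N \<epsilon> \<le> 1\<close>, the Gronwall factor is bounded uniformly in \<open>\<epsilon>\<close>.\<close>
  have "(1 + \<epsilon> * K) ^ N \<le> exp (\<epsilon> * K) ^ N"
    using \<open>\<epsilon> > 0\<close> \<open>K \<ge> 0\<close> by (intro power_mono exp_ge_add_one_self) auto
  also have "\<dots> = exp (\<tau> N * K)" by (simp add: exp_of_nat_mult[symmetric] \<tau>_def mult.assoc)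
  also have "\<dots> \<le> exp K" using N t \<open>K \<ge> 0\<close> mult_right_mono[of "\<tau> N" 1 K] by simp
  finally have pow: "(1 + \<epsilon> * K) ^ N \<le> exp K" .
  have "d N \<le> (C + \<epsilon> * K\<^sup>2) * (1 + \<epsilon> * K) ^ N"
    using \<open>\<epsilon> > 0\<close> \<open>K \<ge> 0\<close> by (intro discrete_gronwall[OF _ d_step]) auto
  also have "\<dots> \<le> (C + \<epsilon> * K\<^sup>2) * exp K"
    using pow \<open>\<epsilon> > 0\<close> \<open>C \<ge> 0\<close> by (intro mult_left_mono) auto
  finally have "d N \<le> exp K * (C + \<epsilon> * K\<^sup>2)" by (simp add: mult.commute)
  moreover have "infnorm (X (\<tau> N) - X t) \<le> \<epsilon> * K"
  proof -
    have "infnorm (X t - X (\<tau> N)) \<le> K * (t - \<tau> N)" using N t \<tau>_ge by (intro X_lip) auto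
    also have "\<dots> \<le> K * \<epsilon>" using N \<open>K \<ge> 0\<close> by (intro mult_left_mono) auto
    finally show ?thesis by (simp add: infnorm_sub mult.commute)
  qed
  moreover have "infnorm (x N - X t) \<le> d N + infnorm (X (\<tau> N) - X t)"
    using infnorm_triangle[of "x N - X (\<tau> N)" "X (\<tau> N) - X t"] by (simp add: d_def)
  ultimately show ?thesis unfolding N_def by linarith
qed

section \<open>Averaging out the fluctuations\<close>

text \<open>
  Abel summation for the partial sums \<open>\<Sum>j<k. v j\<close>, which makes the increments of \<open>x\<close> meet only
  whole partial sums, the objects on which averaging bounds are available.
\<close>

lemma fluctuation_sum_by_parts:
  fixes v :: "nat \<Rightarrow> 'a \<Rightarrow> 'b::ab_group_add"
  shows "(\<Sum>k<Suc n. v k (x k)) =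
    (\<Sum>j<Suc n. v j (x n)) - (\<Sum>k<n. \<Sum>j<Suc k. v j (x (Suc k)) - v j (x k))"
proof (induction n)
  case (Suc n)
  have "(\<Sum>k<Suc (Suc n). v k (x k)) = (\<Sum>k<Suc n. v k (x k)) + v (Suc n) (x (Suc n))" by simp
  also have "\<dots> = (\<Sum>j<Suc n. v j (x n)) - (\<Sum>k<n. \<Sum>j<Suc k. v j (x (Suc k)) - v j (x k))
      + v (Suc n) (x (Suc n))"
    by (simp only: Suc)
  also have "\<dots> = (\<Sum>j<Suc (Suc n). v j (x (Suc n))) -
      (\<Sum>k<Suc n. \<Sum>j<Suc k. v j (x (Suc k)) - v j (x k))"
    by (simp add: sum_subtractf algebra_simps)
  finally show ?case .
qed simp

text \<open>
  By summation by parts the left side is at most \<open>d1\<close> plus fewer than \<open>1/\<epsilon>\<close> increments of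
  sums at a fixed point, over steps of length at most \<open>\<epsilon> K\<close>.  Convexity of \<open>E\<close> keeps the segments between consecutive
  points inside the region where \<open>d2\<close> bounds the derivative.
\<close>

lemma fluctuation_bound:
  fixes x :: "nat \<Rightarrow> real ^ 'd" and v :: "nat \<Rightarrow> real ^ 'd \<Rightarrow> real ^ 'd"
  assumes "\<epsilon> > 0" "K \<ge> 0" "d1 \<ge> 0" "d2 \<ge> 0" "convex E"
    and x_in: "\<And>n. real n * \<epsilon> \<le> 1 \<Longrightarrow> x n \<in> E"
    and x_step: "\<And>n. infnorm (x (Suc n) - x n) \<le> \<epsilon> * K"
    and der: "\<And>j p. p \<in> E \<Longrightarrow> (v j has_derivative (*v) (V j p)) (at p)"
    and d1: "\<And>n p. 1 \<le> n \<Longrightarrow> real n * \<epsilon> \<le> 1 \<Longrightarrow> p \<in> E \<Longrightarrow> \<epsilon> * infnorm (\<Sum>j<n. v j p) \<le> d1"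
    and d2: "\<And>n p. 1 \<le> n \<Longrightarrow> real n * \<epsilon> \<le> 1 \<Longrightarrow> p \<in> E \<Longrightarrow> \<epsilon> * mat_infnorm (\<Sum>j<n. V j p) \<le> d2"
    and n: "real n * \<epsilon> \<le> 1"
  shows "\<epsilon> * infnorm (\<Sum>k<n. v k (x k)) \<le> d1 + K * d2"
proof (cases n)
  case 0
  then show ?thesis using assms by (simp add: infnorm_0)
next
  case (Suc m)
  have small: "real k * \<epsilon> \<le> 1" if "k \<le> n" for k
  proof -
    have "real k * \<epsilon> \<le> real n * \<epsilon>" using that \<open>\<epsilon> > 0\<close> by (intro mult_right_mono) auto
    then show ?thesis using n by linarith
  qed
  have incr: "\<epsilon> * infnorm (\<Sum>j<Suc k. v j (x (Suc k)) - v j (x k)) \<le> d2 * (\<epsilon> * K)" if k: "k < m" for k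
  proof -
    let ?p = "x k" and ?h = "x (Suc k) - x k"
    let ?f = "\<lambda>t. \<Sum>j<Suc k. v j (?p + t *\<^sub>R ?h)"
    let ?A = "\<lambda>t. \<Sum>j<Suc k. V j (?p + t *\<^sub>R ?h)"
    have seg: "?p + t *\<^sub>R ?h \<in> E" if "t \<in> {0..1}" for t
      using convexD_alt[OF \<open>convex E\<close>, of ?p "x (Suc k)" t] x_in[OF small, of k]
        x_in[OF small, of "Suc k"] k Suc that by (simp add: algebra_simps)
    have "infnorm (?f 1 - ?f 0) \<le> (d2 / \<epsilon> * (\<epsilon> * K)) * (1 - 0)"
    proof (rule infnorm_increment_le[where f' = "\<lambda>t. ?A t *v ?h"])
      fix t :: real assume t: "t \<in> {0..1}"
      have "((\<lambda>t. v j (?p + t *\<^sub>R ?h)) has_vector_derivative V j (?p + t *\<^sub>R ?h) *v ?h)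
          (at t within {0..1})" for j
      proof -
        have "((\<lambda>t. ?p + t *\<^sub>R ?h) has_derivative (\<lambda>s. s *\<^sub>R ?h)) (at t)"
          by (auto intro!: derivative_eq_intros)
        from diff_chain_at[OF this der[OF seg[OF t]]]
        have "((\<lambda>t. v j (?p + t *\<^sub>R ?h)) has_derivative (\<lambda>s. V j (?p + t *\<^sub>R ?h) *v (s *\<^sub>R ?h))) (at t)"
          by (simp add: o_def)
        then show ?thesis
          by (auto simp: has_vector_derivative_def matrix_vector_mult_scaleR intro: has_derivative_at_withinI)
      qed
      then have "(?f has_vector_derivative (\<Sum>j<Suc k. V j (?p + t *\<^sub>R ?h) *v ?h)) (at t within {0..1})"
        by (intro has_vector_derivative_sum)
      then show "(?f has_vector_derivative ?A t *v ?h) (at t within {0..1})"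
        by (simp only: sum_matrix_vector_mult)
      have "\<epsilon> * mat_infnorm (?A t) \<le> d2"
        using small[of "Suc k"] k Suc by (intro d2 seg[OF t]) auto
      then have le: "mat_infnorm (?A t) \<le> d2 / \<epsilon>" using \<open>\<epsilon> > 0\<close> by (simp add: field_simps)
      show "infnorm (?A t *v ?h) \<le> d2 / \<epsilon> * (\<epsilon> * K)"
        by (rule order_trans[OF infnorm_mat_mult_le mult_mono[OF le x_step]])
          (use assms in \<open>auto simp: infnorm_pos_le\<close>)
    qed auto
    then have "infnorm (\<Sum>j<Suc k. v j (x (Suc k)) - v j (x k)) \<le> d2 * K"
      using \<open>\<epsilon> > 0\<close> by (simp add: sum_subtractf)
    then show ?thesis using \<open>\<epsilon> > 0\<close> mult_left_mono[of _ "d2 * K" \<epsilon>] by (simp add: mult_ac)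
  qed
  let ?P = "\<Sum>j<Suc m. v j (x m)" and ?Q = "\<Sum>k<m. \<Sum>j<Suc k. v j (x (Suc k)) - v j (x k)"
  have "\<epsilon> * infnorm ?P \<le> d1" using small[of m] small[of "Suc m"] Suc by (intro d1 x_in) auto
  moreover have "\<epsilon> * infnorm ?Q \<le> K * d2"
  proof -
    have "\<epsilon> * infnorm ?Q \<le> (\<Sum>k<m. \<epsilon> * infnorm (\<Sum>j<Suc k. v j (x (Suc k)) - v j (x k)))"
      unfolding sum_distrib_left[symmetric] using \<open>\<epsilon> > 0\<close> by (intro mult_left_mono infnorm_sum_le) auto
    also have "\<dots> \<le> (\<Sum>k<m. d2 * (\<epsilon> * K))" by (intro sum_mono incr) auto
    also have "\<dots> = (real m * \<epsilon>) * (K * d2)" by simp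
    also have "\<dots> \<le> 1 * (K * d2)" using small[of m] Suc assms by (intro mult_right_mono) auto
    finally show ?thesis by simp
  qed
  moreover have "infnorm (?P - ?Q) \<le> infnorm ?P + infnorm ?Q"
    using infnorm_triangle[of ?P "- ?Q"] by (simp only: infnorm_neg diff_conv_add_uminus)
  then have "\<epsilon> * infnorm (?P - ?Q) \<le> \<epsilon> * infnorm ?P + \<epsilon> * infnorm ?Q"
    using \<open>\<epsilon> > 0\<close> by (simp only: distrib_left[symmetric] mult_le_cancel_left_pos)
  ultimately show ?thesis unfolding Suc fluctuation_sum_by_parts by linarith
qed

section \<open>The averaging estimate\<close>

theorem theorem2p2:
  fixes M :: "'m measure"
    and T :: "real \<Rightarrow> 'm \<Rightarrow> 'm"
    and \<nu> :: "real \<Rightarrow> 'm measure"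
    and a :: "real ^ 'd \<Rightarrow> 'm \<Rightarrow> real \<Rightarrow> real ^ 'd"
    and X :: "real \<Rightarrow> real ^ 'd"
    and x0 :: "real ^ 'd"
    and \<epsilon>0 L1 L2 L3 L :: real
    and E :: "(real ^ 'd) set"
  assumes eps0: "\<epsilon>0 > 0"
    and T_meas: "\<And>\<epsilon>. \<epsilon> \<in> {0..<\<epsilon>0} \<Longrightarrow> T \<epsilon> \<in> measurable M M"
    and nu: "\<And>\<epsilon>. \<epsilon> \<in> {0..<\<epsilon>0} \<Longrightarrow> invariant_ergodic_prob M (T \<epsilon>) (\<nu> \<epsilon>)"
    and a_meas: "\<And>x \<epsilon>. \<epsilon> \<in> {0..<\<epsilon>0} \<Longrightarrow> (\<lambda>y. a x y \<epsilon>) \<in> borel_measurable M"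
    and L_ge1: "L1 \<ge> 1" "L2 \<ge> 1" "L3 \<ge> 1"
    and L_def: "L = Max {L1, L2, L3}"
    and E_def: "E = ball_E x0 L1"
    and a_lip: "lip_norm_on infnorm UNIV (space M) {0..<\<epsilon>0} a \<le> ennreal L1"
    and a_diff: "\<And>x y \<epsilon>. x \<in> E \<Longrightarrow> y \<in> space M \<Longrightarrow> \<epsilon> \<in> {0..<\<epsilon>0}
                   \<Longrightarrow> (\<lambda>\<xi>. a \<xi> y \<epsilon>) differentiable (at x)"
    and Da_lip: "lip_norm_on mat_infnorm E (space M) {0..<\<epsilon>0} (Dx a) \<le> ennreal L2"
    and a_eps: "\<And>\<epsilon>. \<epsilon> \<in> {0..<\<epsilon>0} \<Longrightarrow>
                  (SUP x\<in>E. SUP y\<in>space M. ennreal (infnorm (a x y \<epsilon> - a x y 0))) \<le> ennreal (L3 * \<epsilon>)"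
    and X_init: "X 0 = x0"
    and X_ode: "\<And>t. t \<in> {0..1} \<Longrightarrow> (X has_vector_derivative abar a \<nu> (X t) 0) (at t within {0..1})"
  shows "\<forall>\<epsilon>\<in>{0<..<\<epsilon>0}. \<forall>y0\<in>space M. delta a T \<nu> E \<epsilon> y0 \<le> ennreal (1 / 2) \<longrightarrow>
           z_err a T x0 X \<epsilon> y0 \<le> ennreal (6 * exp (2 * L)) * (delta a T \<nu> E \<epsilon> y0 + S_err a \<nu> E \<epsilon>)"
proof (intro ballI impI)
  fix \<epsilon> y0
  assume eps: "\<epsilon> \<in> {0<..<\<epsilon>0}" and y0: "y0 \<in> space M"
    and delta_le: "delta a T \<nu> E \<epsilon> y0 \<le> ennreal (1 / 2)"
  have \<epsilon>: "\<epsilon> > 0" "\<epsilon> \<in> {0..<\<epsilon>0}" and zero: "0 \<in> {0..<\<epsilon>0}" using eps by auto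
  have L: "L1 \<le> L" "L3 \<le> L" "L \<ge> 1" using L_ge1 by (auto simp: L_def)
  have a_le: "infnorm (a p y e) \<le> L1" if "y \<in> space M" "e \<in> {0..<\<epsilon>0}" for p y e
    using a_lip that L_ge1 by (simp add: lip_norm_on_def SUP_le_iff)
  have a_lipschitz: "infnorm (a p y e - a q y e) \<le> L1 * infnorm (p - q)"
    if "y \<in> space M" "e \<in> {0..<\<epsilon>0}" for p q y e
  proof (cases "p = q")
    case False
    then have "infnorm (a p y e - a q y e) / infnorm (p - q) \<le> L1"
      using a_lip that L_ge1 by (auto simp: lip_norm_on_def SUP_le_iff)
    then show ?thesis using False by (simp add: field_simps infnorm_pos_lt)
  qed (simp add: infnorm_0)
  have a_eps_le: "infnorm (a p y \<epsilon> - a p y 0) \<le> L3 * \<epsilon>" if "p \<in> E" "y \<in> space M" for p y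
    using a_eps[OF \<epsilon>(2)] that \<epsilon>(1) L_ge1 by (simp add: SUP_le_iff)
  have prob: "prob_space (\<nu> e)" and space_nu: "space (\<nu> e) = space M" and sets_nu: "sets (\<nu> e) = sets M"
    if "e \<in> {0..<\<epsilon>0}" for e
    using nu[OF that] by (auto simp: invariant_ergodic_prob_def dest: sets_eq_imp_space_eq)
  have a_int: "integrable (\<nu> e') (\<lambda>y. a p y e)" if e: "e \<in> {0..<\<epsilon>0}" "e' \<in> {0..<\<epsilon>0}" for p e e'
  proof -
    interpret prob_space "\<nu> e'" by (rule prob[OF e(2)])
    have "norm (a p y e) \<le> sqrt DIM(real ^ 'd) * L1" if "y \<in> space M" for y
      by (rule order_trans[OF norm_le_infnorm mult_left_mono[OF a_le[OF that e(1)]]]) simp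
    moreover have "(\<lambda>y. a p y e) \<in> borel_measurable (\<nu> e')"
      using a_meas[OF e(1)] measurable_cong_sets[OF sets_nu[OF e(2)] refl] by blast
    ultimately show ?thesis
      by (intro integrable_const_bound[where B = "sqrt DIM(real ^ 'd) * L1"]) (auto simp: space_nu[OF e(2)])
  qed
  define g where "g p = abar a \<nu> p 0" for p
  have g_le: "infnorm (g p) \<le> L1" for p
    unfolding g_def abar_def
    by (rule infnorm_integral_le) (use zero in \<open>auto intro: prob a_int a_le simp: space_nu\<close>)
  have g_lip: "infnorm (g p - g q) \<le> L1 * infnorm (p - q)" for p q
    unfolding g_def abar_def Bochner_Integration.integral_diff[OF a_int[OF zero zero] a_int[OF zero zero], symmetric]
    by (rule infnorm_integral_le)
      (use zero in \<open>auto intro!: Bochner_Integration.integrable_diff intro: prob a_int a_lipschitz simp: space_nu\<close>)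
  define y where "y j = (T \<epsilon> ^^ j) y0" for j
  have y_in: "y j \<in> space M" for j
    unfolding y_def by (induction j) (use y0 measurable_space[OF T_meas[OF \<epsilon>(2)]] in auto)
  define x where "x = slow a T x0 \<epsilon> y0"
  have x_Suc: "x (Suc n) = x n + \<epsilon> *\<^sub>R a (x n) (y n) \<epsilon>" for n
    by (simp add: x_def y_def)
  have x_0: "x 0 = x0" by (simp add: x_def)
  have x_step: "infnorm (x (Suc n) - x n) \<le> \<epsilon> * L1" for n
    using a_le[OF y_in \<epsilon>(2)] \<epsilon>(1) by (simp add: x_Suc infnorm_mul)
  have x_dist: "infnorm (x n - x0) \<le> real n * \<epsilon> * L1" for n
  proof (induction n)
    case (Suc n)
    then show ?case
      using infnorm_triangle[of "x (Suc n) - x n" "x n - x0"] x_step[of n] by (simp add: algebra_simps)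
  qed (simp add: x_0 infnorm_0)
  have x_in: "x n \<in> E" if "real n * \<epsilon> \<le> 1" for n
  proof -
    have "real n * \<epsilon> * L1 \<le> 1 * L1" using that L_ge1 by (intro mult_right_mono) auto
    then show ?thesis using x_dist[of n] by (simp add: E_def ball_E_def)
  qed
  have "convex E"
  proof (rule convexI)
    fix p q and u v :: real
    assume pq: "p \<in> E" "q \<in> E" and uv: "0 \<le> u" "0 \<le> v" "u + v = 1"
    have "u *\<^sub>R p + v *\<^sub>R q - x0 = u *\<^sub>R (p - x0) + v *\<^sub>R (q - x0)"
      using uv(3) by (simp add: algebra_simps scaleR_add_left[symmetric])
    then have "infnorm (u *\<^sub>R p + v *\<^sub>R q - x0) \<le> u * infnorm (p - x0) + v * infnorm (q - x0)"
      using infnorm_triangle[of "u *\<^sub>R (p - x0)" "v *\<^sub>R (q - x0)"] uv by (simp add: infnorm_mul)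
    also have "\<dots> \<le> L1" using pq uv by (intro convex_bound_le) (auto simp: E_def ball_E_def)
    finally show "u *\<^sub>R p + v *\<^sub>R q \<in> E" by (simp add: E_def ball_E_def)
  qed
  \<comment> \<open>The Jacobian in \<open>Dx\<close> is a genuine derivative only once the averaged field is differentiable.\<close>
  have v_der: "((\<lambda>\<xi>. vdev a \<nu> \<xi> (y j) \<epsilon>) has_derivative (*v) (Dx (vdev a \<nu>) p (y j) \<epsilon>)) (at p)"
    if p: "p \<in> E" for j p
  proof -
    interpret prob_space "\<nu> \<epsilon>" by (rule prob[OF \<epsilon>(2)])
    have "((\<lambda>\<xi>. \<integral>y. a \<xi> y \<epsilon> \<partial>\<nu> \<epsilon>) has_derivative
        (\<lambda>h. \<integral>y. frechet_derivative (\<lambda>\<xi>. a \<xi> y \<epsilon>) (at p) h \<partial>\<nu> \<epsilon>)) (at p)"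
    proof (rule has_derivative_integral_lipschitz[where K = "sqrt DIM(real ^ 'd) * L1"])
      show "finite_measure (\<nu> \<epsilon>)" by (rule finite_measure_axioms)
      show "integrable (\<nu> \<epsilon>) (\<lambda>y. a \<xi> y \<epsilon>)" for \<xi> by (rule a_int[OF \<epsilon>(2) \<epsilon>(2)])
      fix y assume "y \<in> space (\<nu> \<epsilon>)"
      then have y: "y \<in> space M" by (simp add: space_nu[OF \<epsilon>(2)])
      show "((\<lambda>\<xi>. a \<xi> y \<epsilon>) has_derivative frechet_derivative (\<lambda>\<xi>. a \<xi> y \<epsilon>) (at p)) (at p)"
        using a_diff[OF p y \<epsilon>(2)] by (simp add: frechet_derivative_works)
      fix \<xi>
      have "norm (a \<xi> y \<epsilon> - a p y \<epsilon>) \<le> sqrt DIM(real ^ 'd) * infnorm (a \<xi> y \<epsilon> - a p y \<epsilon>)"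
        by (rule norm_le_infnorm)
      also have "\<dots> \<le> sqrt DIM(real ^ 'd) * (L1 * norm (\<xi> - p))"
        using L_ge1 by (intro mult_left_mono order_trans[OF a_lipschitz[OF y \<epsilon>(2)]] infnorm_le_norm) auto
      finally show "norm (a \<xi> y \<epsilon> - a p y \<epsilon>) \<le> sqrt DIM(real ^ 'd) * L1 * norm (\<xi> - p)"
        by (simp add: mult.assoc)
    qed
    then have "(\<lambda>\<xi>. abar a \<nu> \<xi> \<epsilon>) differentiable (at p)"
      unfolding abar_def by (rule differentiableI)
    then have "(\<lambda>\<xi>. vdev a \<nu> \<xi> (y j) \<epsilon>) differentiable (at p)"
      unfolding vdev_def by (intro differentiable_diff a_diff[OF p y_in \<epsilon>(2)])
    then show ?thesis unfolding Dx_def by (simp add: jacobian_works)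
  qed
  have delta_fin: "delta1 a T \<nu> E \<epsilon> y0 < top" "delta2 a T \<nu> E \<epsilon> y0 < top"
    using le_less_trans[OF delta_le ennreal_less_top] by (auto simp: delta_def)
  obtain d1 where d1: "delta1 a T \<nu> E \<epsilon> y0 = ennreal d1" "d1 \<ge> 0"
    using delta_fin(1) by (cases "delta1 a T \<nu> E \<epsilon> y0") auto
  obtain d2 where d2: "delta2 a T \<nu> E \<epsilon> y0 = ennreal d2" "d2 \<ge> 0"
    using delta_fin(2) by (cases "delta2 a T \<nu> E \<epsilon> y0") auto
  have d1_bound: "\<epsilon> * infnorm (\<Sum>j<n. vdev a \<nu> p (y j) \<epsilon>) \<le> d1"
    if "1 \<le> n" "real n * \<epsilon> \<le> 1" "p \<in> E" for n p
  proof -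
    have "ennreal (\<epsilon> * infnorm (v_sum a T \<nu> \<epsilon> p n y0)) \<le> delta1 a T \<nu> E \<epsilon> y0"
      unfolding delta1_def using that \<epsilon>(1)
      by (intro SUP_upper2[OF that(3)] SUP_upper) (auto simp: field_simps)
    then show ?thesis using d1 by (simp add: v_sum_def y_def)
  qed
  have d2_bound: "\<epsilon> * mat_infnorm (\<Sum>j<n. Dx (vdev a \<nu>) p (y j) \<epsilon>) \<le> d2"
    if "1 \<le> n" "real n * \<epsilon> \<le> 1" "p \<in> E" for n p
  proof -
    have "ennreal (\<epsilon> * mat_infnorm (V_sum a T \<nu> \<epsilon> p n y0)) \<le> delta2 a T \<nu> E \<epsilon> y0"
      unfolding delta2_def using that \<epsilon>(1)
      by (intro SUP_upper2[OF that(3)] SUP_upper) (auto simp: field_simps)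
    then show ?thesis using d2 by (simp add: V_sum_def y_def)
  qed
  define S where "S = (SUP p\<in>E. ennreal (infnorm ((\<integral>y. a p y 0 \<partial>(\<nu> \<epsilon>)) - (\<integral>y. a p y 0 \<partial>(\<nu> 0)))))"
  have "infnorm ((\<integral>y. a p y 0 \<partial>(\<nu> \<epsilon>)) - (\<integral>y. a p y 0 \<partial>(\<nu> 0))) \<le> 2 * L1" for p
  proof -
    have "infnorm (\<integral>y. a p y 0 \<partial>(\<nu> e)) \<le> L1" if "e \<in> {0..<\<epsilon>0}" for e
      by (rule infnorm_integral_le) (use zero that in \<open>auto intro: prob a_int a_le simp: space_nu\<close>)
    from this[OF \<epsilon>(2)] this[OF zero] show ?thesis
      using infnorm_triangle[of "\<integral>y. a p y 0 \<partial>(\<nu> \<epsilon>)" "- (\<integral>y. a p y 0 \<partial>(\<nu> 0))"]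
      by (simp add: infnorm_neg)
  qed
  then have "S \<le> ennreal (2 * L1)" unfolding S_def by (intro SUP_least ennreal_leI)
  then have "S < top" by (rule le_less_trans) simp
  then obtain s where s: "S = ennreal s" "s \<ge> 0" by (cases S) auto
  have s_bound: "infnorm ((\<integral>y. a p y 0 \<partial>(\<nu> \<epsilon>)) - (\<integral>y. a p y 0 \<partial>(\<nu> 0))) \<le> s" if "p \<in> E" for p
  proof -
    have "ennreal (infnorm ((\<integral>y. a p y 0 \<partial>(\<nu> \<epsilon>)) - (\<integral>y. a p y 0 \<partial>(\<nu> 0)))) \<le> S"
      unfolding S_def by (rule SUP_upper[OF that])
    then show ?thesis using s by simp
  qed
  have abar_bound: "infnorm (abar a \<nu> p \<epsilon> - g p) \<le> L3 * \<epsilon> + s" if p: "p \<in> E" for p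
  proof -
    have "infnorm (\<integral>y. a p y \<epsilon> - a p y 0 \<partial>(\<nu> \<epsilon>)) \<le> L3 * \<epsilon>"
      by (rule infnorm_integral_le)
        (use zero \<epsilon> a_eps_le p in \<open>auto intro!: prob a_int Bochner_Integration.integrable_diff simp: space_nu\<close>)
    moreover have "abar a \<nu> p \<epsilon> - g p = (\<integral>y. a p y \<epsilon> - a p y 0 \<partial>(\<nu> \<epsilon>)) +
        ((\<integral>y. a p y 0 \<partial>(\<nu> \<epsilon>)) - (\<integral>y. a p y 0 \<partial>(\<nu> 0)))"
      by (simp add: Bochner_Integration.integral_diff[OF a_int[OF \<epsilon>(2) \<epsilon>(2)] a_int[OF zero \<epsilon>(2)]] g_def abar_def)
    ultimately show ?thesis using infnorm_triangle s_bound[OF p]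
      by (smt (verit, best))
  qed
  define C where "C = d1 + L1 * d2 + (L3 * \<epsilon> + s)"
  have euler: "infnorm (x n - (x 0 + \<epsilon> *\<^sub>R (\<Sum>k<n. g (x k)))) \<le> C" if n: "real n * \<epsilon> \<le> 1" for n
  proof -
    let ?F = "\<Sum>k<n. vdev a \<nu> (x k) (y k) \<epsilon>" and ?B = "\<Sum>k<n. abar a \<nu> (x k) \<epsilon> - g (x k)"
    have "x n = x 0 + \<epsilon> *\<^sub>R (\<Sum>k<n. a (x k) (y k) \<epsilon>)"
      by (induction n) (simp_all add: x_Suc algebra_simps)
    then have "x n - (x 0 + \<epsilon> *\<^sub>R (\<Sum>k<n. g (x k))) = \<epsilon> *\<^sub>R ?F + \<epsilon> *\<^sub>R ?B"
      by (simp add: vdev_def sum_subtractf algebra_simps)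
    moreover have "infnorm (\<epsilon> *\<^sub>R ?F) \<le> d1 + L1 * d2"
      using fluctuation_bound[where v = "\<lambda>j p. vdev a \<nu> p (y j) \<epsilon>"
          and V = "\<lambda>j p. Dx (vdev a \<nu>) p (y j) \<epsilon>" and x = x,
          OF \<epsilon>(1) _ d1(2) d2(2) \<open>convex E\<close> x_in x_step v_der d1_bound d2_bound n] \<epsilon>(1) L_ge1
      by (simp add: infnorm_mul)
    moreover have "infnorm (\<epsilon> *\<^sub>R ?B) \<le> L3 * \<epsilon> + s"
    proof -
      have small: "real k * \<epsilon> \<le> 1" if "k < n" for k
      proof -
        have "real k * \<epsilon> \<le> real n * \<epsilon>" using that \<epsilon>(1) by (intro mult_right_mono) auto
        then show ?thesis using n by linarith
      qed
      have "infnorm ?B \<le> (\<Sum>k<n. L3 * \<epsilon> + s)"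
        by (intro order_trans[OF infnorm_sum_le] sum_mono abar_bound x_in small) auto
      then have "\<epsilon> * infnorm ?B \<le> \<epsilon> * (real n * (L3 * \<epsilon> + s))"
        using \<epsilon>(1) by (intro mult_left_mono) auto
      also have "\<dots> = (real n * \<epsilon>) * (L3 * \<epsilon> + s)" by (simp add: mult_ac)
      also have "\<dots> \<le> 1 * (L3 * \<epsilon> + s)" using n \<epsilon>(1) s L_ge1 by (intro mult_right_mono) auto
      finally show ?thesis using \<epsilon>(1) by (simp add: infnorm_mul)
    qed
    ultimately show ?thesis using infnorm_triangle[of "\<epsilon> *\<^sub>R ?F" "\<epsilon> *\<^sub>R ?B"] by (simp add: C_def)
  qed
  have C: "C \<ge> 0" using d1 d2 s \<epsilon>(1) L_ge1 by (simp add: C_def)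
  have const: "exp L1 * (C + \<epsilon> * L1\<^sup>2) + \<epsilon> * L1 \<le> 6 * exp (2 * L) * (d1 + d2 + (s + \<epsilon>))"
  proof -
    \<comment> \<open>One factor \<open>Q\<close> is the Gronwall factor, the other absorbs \<open>L1\<close>, \<open>L3\<close> and \<open>L1\<^sup>2 \<le> L\<^sup>2 \<le> 2 Q\<close>.\<close>
    define Q where "Q = exp L"
    have "1 + L + L\<^sup>2 / 2 \<le> Q" unfolding Q_def using L by (intro exp_lower_Taylor_quadratic) auto
    moreover have "L1\<^sup>2 \<le> L\<^sup>2" using L L_ge1 by (intro power_mono) auto
    moreover have "L\<^sup>2 \<ge> 0" by simp
    ultimately have Q: "L1 \<le> Q" "L3 \<le> Q" "L1\<^sup>2 \<le> 2 * Q" "1 \<le> Q" using L by linarith+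
    have "L1 * d2 \<le> Q * d2" "L3 * \<epsilon> \<le> Q * \<epsilon>" "\<epsilon> * L1\<^sup>2 \<le> \<epsilon> * (2 * Q)"
      using Q \<epsilon>(1) d2 by (auto intro: mult_right_mono mult_left_mono)
    moreover have "1 * (d1 + s) \<le> Q * (d1 + s)"
      using Q d1 s by (intro mult_right_mono) auto
    ultimately have inner: "C + \<epsilon> * L1\<^sup>2 \<le> Q * (d1 + d2 + s + 3 * \<epsilon>)" by (simp add: C_def algebra_simps)
    have "exp L1 * (C + \<epsilon> * L1\<^sup>2) \<le> Q * (Q * (d1 + d2 + s + 3 * \<epsilon>))"
      using inner L Q C \<epsilon>(1) by (intro mult_mono) (auto simp: Q_def)
    moreover have "\<epsilon> * L1 \<le> \<epsilon> * (Q * Q)"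
      using Q \<epsilon>(1) mult_mono[of L1 Q 1 Q] L_ge1 by (intro mult_left_mono) auto
    ultimately have "exp L1 * (C + \<epsilon> * L1\<^sup>2) + \<epsilon> * L1 \<le> (Q * Q) * (d1 + d2 + s + 4 * \<epsilon>)"
      by (simp add: algebra_simps)
    also have "\<dots> \<le> (Q * Q) * (6 * (d1 + d2 + (s + \<epsilon>)))"
      using d1 d2 s \<epsilon>(1) by (intro mult_left_mono) auto
    also have "Q * Q = exp (2 * L)" by (simp add: Q_def exp_add[symmetric])
    finally show ?thesis by (simp only: mult_ac)
  qed
  have "infnorm (slow_hat a T x0 \<epsilon> y0 t - X t) \<le> 6 * exp (2 * L) * (d1 + d2 + (s + \<epsilon>))"
    if t: "t \<in> {0..1}" for t
  proof -
    have "infnorm (x (nat \<lfloor>t / \<epsilon>\<rfloor>) - X t) \<le> exp L1 * (C + \<epsilon> * L1\<^sup>2) + \<epsilon> * L1"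
      by (rule perturbed_euler_error[where g = g, OF \<epsilon>(1) _ C g_le g_lip _ _ euler t])
        (use L_ge1 X_init X_ode in \<open>auto simp: x_0 g_def\<close>)
    then show ?thesis using const by (simp add: slow_hat_def x_def)
  qed
  then have "z_err a T x0 X \<epsilon> y0 \<le> ennreal (6 * exp (2 * L) * (d1 + d2 + (s + \<epsilon>)))"
    unfolding z_err_def by (intro SUP_least ennreal_leI)
  also have "\<dots> = ennreal (6 * exp (2 * L)) * (delta a T \<nu> E \<epsilon> y0 + S_err a \<nu> E \<epsilon>)"
    using d1 d2 s \<epsilon>(1)
    by (simp add: delta_def S_err_def S_def[symmetric] ennreal_mult ennreal_plus)
  finally show "z_err a T x0 X \<epsilon> y0 \<le>
      ennreal (6 * exp (2 * L)) * (delta a T \<nu> E \<epsilon> y0 + S_err a \<nu> E \<epsilon>)" .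
qed

end
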